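(* Let $\mathcal{L}$ be a commutative subspace lattice acting on a separable Hilbert space $\mathcal{H}$. The following conditions are equivalent: (1) $\mathcal{L}$ is hyperatomic, i.e. every non-zero projection in $\mathcal{L}$ is generated by finitely many atoms from $\mathcal{L}$. (2) Every ascending sequence $F_1 \leq F_2 \leq \cdots$ of projections in $\mathcal{L}$ is eventually constant. (3) Every invariant operator range for $\operatorname{Alg}\mathcal{L}$ is a closed subspace (and therefore an element of $\mathcal{L}$). (4) Every invariant linear manifold for $\operatorname{Alg}\mathcal{L}$ is a closed subspace (and therefore an element of $\mathcal{L}$). If, in addition, $\mathcal{L}$ is a nest, then the following conditions are also equivalent to each of the conditions (1)–(4): (5) Every non-zero projection in $\mathcal{L}$ has an immediate predecessor in $\mathcal{L}$. (6) The invariant operator ranges for $\operatorname{Alg}\mathcal{L}$ are totally ordered by inclusion. (7) The invariant linear manifolds for $\operatorname{Alg}\mathcal{L}$ are totally ordered by inclusion.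
   Context: Closed subspaces of a Hilbert space $\mathcal{H}$ are identified with the orthogonal projections onto them, and the same symbol is used for both; $\leq$ is the usual order on projections (inclusion of ranges). A commutative subspace lattice $\mathcal{L}$ on $\mathcal{H}$ is a family of mutually commuting orthogonal projections on $\mathcal{H}$ which contains $0$ and $I$ and which is a complete lattice of closed subspaces: it is closed under arbitrary intersections and arbitrary closed linear spans (equivalently, it is a lattice of commuting projections containing $0$ and $I$ and closed in the strong operator topology). A nest is a commutative subspace lattice that is totally ordered. $\operatorname{Alg}\mathcal{L}$ is the algebra of all bounded linear operators $T$ on $\mathcal{H}$ which leave invariant (the range of) each projection in $\mathcal{L}$, i.e. $TP = PTP$ for all $P\in\mathcal{L}$. A linear manifold is a (not necessarily closed) linear subspace of $\mathcal{H}$. A linear manifold $\mathcal{M}$ is invariant for $\operatorname{Alg}\mathcal{L}$ if $T\mathcal{M}\subseteq\mathcal{M}$ for all $T\in\operatorname{Alg}\mathcal{L}$. An operator range is the range of a bounded linear operator acting on $\mathcal{H}$; an invariant operator range for $\operatorname{Alg}\mathcal{L}$ is an operator range which is an invariant linear manifold for $\operatorname{Alg}\mathcal{L}$. An atom from $\mathcal{L}$ is a minimal non-zero interval from $\mathcal{L}$: a projection $A$ of the form $A = P-Q$ with $P,Q\in\mathcal{L}$, $Q<P$, such that for every $F\in\mathcal{L}$ the product $AF$ is either $0$ or $A$. (An atom need not belong to $\mathcal{L}$.) A projection $P \in \mathcal{L}$ is generated by a set of atoms if $P$ is the smallest projection in $\mathcal{L}$ containing each atom of the set, i.e. $P=\bigwedge\{F\in\mathcal{L}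 : A\leq F \text{ for every atom } A \text{ in the set}\}$. In a nest $\mathcal{L}$, a non-zero projection $P\in\mathcal{L}$ has an immediate predecessor if there is $Q\in\mathcal{L}$ with $Q<P$ and no $F\in\mathcal{L}$ satisfying $Q<F<P$. *)

theory Defs
  imports "HOL-Analysis.Analysis"
begin

text \<open>
  The norm, the topology and the real inner product come from \<^class>\<open>real_inner\<close>; the
  complex structure is tied to them by \<open>x \<bullet> y = Re (cinner x y)\<close>, so that
  \<open>cinner x x = (norm x)\<^sup>2\<close>. The form is linear in the first argument.
\<close>

class complex_inner = real_inner +
  fixes scaleC :: "complex \<Rightarrow> 'a \<Rightarrow> 'a" (infixr "*\<^sub>C" 75)
    and cinner :: "'a \<Rightarrow> 'a \<Rightarrow> complex"
  assumes scaleC_add_right: "c *\<^sub>C (x + y) = c *\<^sub>C x + c *\<^sub>C y"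
    and scaleC_add_left: "(c + d) *\<^sub>C x = c *\<^sub>C x + d *\<^sub>C x"
    and scaleC_scaleC: "c *\<^sub>C d *\<^sub>C x = (c * d) *\<^sub>C x"
    and scaleC_of_real: "complex_of_real r *\<^sub>C x = r *\<^sub>R x"
    and cinner_commute: "cinner x y = cnj (cinner y x)"
    and cinner_add_left: "cinner (x + y) z = cinner x z + cinner y z"
    and cinner_scaleC_left: "cinner (c *\<^sub>C x) y = c * cinner x y"
    and inner_eq_Re_cinner: "x \<bullet> y = Re (cinner x y)"

class chilbert_space = complex_inner + complete_space

instantiation complex :: chilbert_space
begin

definition scaleC_complex :: "complex \<Rightarrow> complex \<Rightarrow> complex" where
  "scaleC_complex c x = c * x"

definition cinner_complex :: "complex \<Rightarrow> complex \<Rightarrow> complex" where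
  "cinner_complex x y = x * cnj y"

instance
  by standard
    (auto simp: scaleC_complex_def cinner_complex_def inner_complex_def scaleR_conv_of_real
      algebra_simps)

end

global_interpretation complex_vector:
  vector_space "scaleC :: complex \<Rightarrow> 'a \<Rightarrow> 'a::complex_inner"
  defines csubspace = complex_vector.subspace
    and cspan = complex_vector.span
proof
  show "1 *\<^sub>C x = x" for x :: 'a
    using scaleC_of_real[of 1 x] by simp
qed (simp_all add: scaleC_add_right scaleC_add_left scaleC_scaleC)

text \<open>
  \<open>'a \<Rightarrow>\<^sub>L 'a\<close> is the type of bounded \<^emph>\<open>real\<close>-linear operators; \<open>bounded_op\<close> singles out
  the complex-linear ones.
\<close>

definition bounded_op :: "('a::complex_inner \<Rightarrow>\<^sub>L 'a) \<Rightarrow> bool" where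
  "bounded_op T \<longleftrightarrow> (\<forall>c x. blinfun_apply T (c *\<^sub>C x) = c *\<^sub>C blinfun_apply T x)"

definition op_range :: "('a::complex_inner \<Rightarrow>\<^sub>L 'a) \<Rightarrow> 'a set" where
  "op_range T = range (blinfun_apply T)"

definition is_projection :: "('a::complex_inner \<Rightarrow>\<^sub>L 'a) \<Rightarrow> bool" where
  "is_projection P \<longleftrightarrow> bounded_op P \<and> P o\<^sub>L P = P \<and>
     (\<forall>x y. cinner (blinfun_apply P x) y = cinner x (blinfun_apply P y))"

definition proj_le :: "('a::complex_inner \<Rightarrow>\<^sub>L 'a) \<Rightarrow> ('a \<Rightarrow>\<^sub>L 'a) \<Rightarrow> bool" (infix "\<preceq>" 50) where
  "P \<preceq> Q \<longleftrightarrow> op_range P \<subseteq> op_range Q"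

definition proj_less :: "('a::complex_inner \<Rightarrow>\<^sub>L 'a) \<Rightarrow> ('a \<Rightarrow>\<^sub>L 'a) \<Rightarrow> bool" (infix "\<prec>" 50) where
  "P \<prec> Q \<longleftrightarrow> P \<preceq> Q \<and> P \<noteq> Q"

definition commutative_subspace_lattice :: "('a::complex_inner \<Rightarrow>\<^sub>L 'a) set \<Rightarrow> bool" where
  "commutative_subspace_lattice L \<longleftrightarrow>
     (\<forall>P\<in>L. is_projection P) \<and>
     (\<forall>P\<in>L. \<forall>Q\<in>L. P o\<^sub>L Q = Q o\<^sub>L P) \<and>
     0 \<in> L \<and> id_blinfun \<in> L \<and>
     (\<forall>S\<subseteq>L. \<exists>R\<in>L. op_range R = (\<Inter>P\<in>S. op_range P)) \<and>
     (\<forall>S\<subseteq>L. \<exists>R\<in>L. op_range R = closure (cspan (\<Union>P\<in>S. op_range P)))"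

definition nest :: "('a::complex_inner \<Rightarrow>\<^sub>L 'a) set \<Rightarrow> bool" where
  "nest L \<longleftrightarrow> commutative_subspace_lattice L \<and> (\<forall>P\<in>L. \<forall>Q\<in>L. P \<preceq> Q \<or> Q \<preceq> P)"

definition Alg :: "('a::complex_inner \<Rightarrow>\<^sub>L 'a) set \<Rightarrow> ('a \<Rightarrow>\<^sub>L 'a) set" where
  "Alg L = {T. bounded_op T \<and> (\<forall>P\<in>L. T o\<^sub>L P = P o\<^sub>L T o\<^sub>L P)}"

definition invariant_manifold :: "('a::complex_inner \<Rightarrow>\<^sub>L 'a) set \<Rightarrow> 'a set \<Rightarrow> bool" where
  "invariant_manifold L M \<longleftrightarrow>
     csubspace M \<and> (\<forall>T\<in>Alg L. blinfun_apply T ` M \<subseteq> M)"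

definition operator_range :: "'a::complex_inner set \<Rightarrow> bool" where
  "operator_range M \<longleftrightarrow> (\<exists>T. bounded_op T \<and> M = op_range T)"

definition invariant_operator_range :: "('a::complex_inner \<Rightarrow>\<^sub>L 'a) set \<Rightarrow> 'a set \<Rightarrow> bool" where
  "invariant_operator_range L M \<longleftrightarrow> operator_range M \<and> invariant_manifold L M"

definition atom_from :: "('a::complex_inner \<Rightarrow>\<^sub>L 'a) set \<Rightarrow> ('a \<Rightarrow>\<^sub>L 'a) \<Rightarrow> bool" where
  "atom_from L A \<longleftrightarrow>
     (\<exists>P\<in>L. \<exists>Q\<in>L. Q \<prec> P \<and> A = P - Q) \<and> (\<forall>F\<in>L. A o\<^sub>L F = 0 \<or> A o\<^sub>L F = A)"

definition generated_by ::
  "('a::complex_inner \<Rightarrow>\<^sub>L 'a) set \<Rightarrow> ('a \<Rightarrow>\<^sub>L 'a) set \<Rightarrow> ('a \<Rightarrow>\<^sub>L 'a) \<Rightarrow> bool" where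
  "generated_by L S P \<longleftrightarrow>
     P \<in> L \<and> (\<forall>A\<in>S. A \<preceq> P) \<and> (\<forall>F\<in>L. (\<forall>A\<in>S. A \<preceq> F) \<longrightarrow> P \<preceq> F)"

definition hyperatomic :: "('a::complex_inner \<Rightarrow>\<^sub>L 'a) set \<Rightarrow> bool" where
  "hyperatomic L \<longleftrightarrow>
     (\<forall>P\<in>L. P \<noteq> 0 \<longrightarrow> (\<exists>S. finite S \<and> (\<forall>A\<in>S. atom_from L A) \<and> generated_by L S P))"

definition has_immediate_predecessor ::
  "('a::complex_inner \<Rightarrow>\<^sub>L 'a) set \<Rightarrow> ('a \<Rightarrow>\<^sub>L 'a) \<Rightarrow> bool" where
  "has_immediate_predecessor L P \<longleftrightarrow> (\<exists>Q\<in>L. Q \<prec> P \<and> \<not> (\<exists>F\<in>L. Q \<prec> F \<and> F \<prec> P))"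

definition ascending_stabilizes :: "('a::complex_inner \<Rightarrow>\<^sub>L 'a) set \<Rightarrow> bool" where
  "ascending_stabilizes L \<longleftrightarrow>
     (\<forall>F :: nat \<Rightarrow> 'a \<Rightarrow>\<^sub>L 'a. (\<forall>n. F n \<in> L) \<and> (\<forall>n. F n \<preceq> F (Suc n)) \<longrightarrow>
        (\<exists>N. \<forall>n\<ge>N. F n = F N))"

definition totally_ordered :: "'a set set \<Rightarrow> bool" where
  "totally_ordered \<M> \<longleftrightarrow> (\<forall>M\<in>\<M>. \<forall>N\<in>\<M>. M \<subseteq> N \<or> N \<subseteq> M)"

end

theory Submission
  imports Defs
begin

text \<open>
  Everything is compared with the ascending chain condition. Under it every non-zero interval of
  \<open>L\<close> has an atom at its top; if \<open>A\<close> is an atom and \<open>E\<close> the least element of \<open>L\<close> above it, then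
  all rank-one operators from \<open>A\<close> to \<open>E\<close> lie in \<open>Alg L\<close>, and they fill up every invariant manifold
  to an element of \<open>L\<close>. Conversely, a strictly ascending sequence \<open>F\<close> with differences \<open>D k\<close> and
  rapidly decreasing weights \<open>w\<close> gives the operator \<open>\<Sum>k. w k *\<^sub>R D k\<close>, whose range is invariant
  but not closed; two suitably oscillating weights give incomparable ranges.
\<close>

text \<open>Two obstacles shape the argument. An invariant manifold M need not be closed, whereas a
  lattice join is a closed span and might leave M. Commutativity removes this: the join of P and Q
  is P + Q - P Q, so its range stays inside the algebraic sum of the two ranges, and an element of
  \<open>L\<close> inside M can be enlarged without leaving M.

  In the other direction, the range of a diagonal operator has to survive all of
  \<open>Alg L\<close>. An operator T in \<open>Alg L\<close> is upper triangular along the chain: D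
  k T vanishes on the range of F k. A vector in the weighted range has a tail beyond F (Suc k) of
  size at most a multiple of w (Suc k), so after division by w k only the ratio of consecutive
  weights remains; this is why the weights decrease faster than geometrically. Closedness of such a
  range, or containment of one in another, can then be tested on one coordinate at a time and forces
  an inequality between numbers, which exponents of quadratic growth are able to violate.\<close>

instance chilbert_space \<subseteq> banach ..

no_notation lesspoll (infixl "\<prec>" 50)

section \<open>Projections\<close>

lemma cinner_self_nonzero: "x \<noteq> 0 \<Longrightarrow> cinner x x \<noteq> 0"
  by (metis inner_eq_Re_cinner inner_eq_zero_iff zero_complex.simps(1))

lemma cinner_scaleC_right: "cinner x (c *\<^sub>C y) = cnj c * cinner x y"
  by (simp only: cinner_commute[of x "c *\<^sub>C y"] cinner_commute[of x y] cinner_scaleC_left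
      complex_cnj_mult)

lemma norm_scaleC: "norm (c *\<^sub>C x) = cmod c * norm x"
proof -
  have "cinner (c *\<^sub>C x) (c *\<^sub>C x) = c * cnj c * cinner x x"
    by (simp add: cinner_scaleC_left cinner_scaleC_right)
  also have "c * cnj c = complex_of_real ((cmod c)\<^sup>2)"
    by (simp only: complex_norm_square)
  finally have "(norm (c *\<^sub>C x))\<^sup>2 = (cmod c * norm x)\<^sup>2"
    by (simp add: power2_norm_eq_inner inner_eq_Re_cinner power_mult_distrib)
  then show ?thesis
    by (simp add: power2_eq_iff_nonneg)
qed

lemma bounded_linear_scaleC: "bounded_linear (\<lambda>x::'a::complex_inner. c *\<^sub>C x)"
proof (rule bounded_linear_intro)
  show "c *\<^sub>C (x + y) = c *\<^sub>C x + c *\<^sub>C y" for x y :: 'a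
    by (rule scaleC_add_right)
  show "c *\<^sub>C (r *\<^sub>R x) = r *\<^sub>R (c *\<^sub>C x)" for r and x :: 'a
    by (simp add: scaleC_of_real[symmetric] scaleC_scaleC mult.commute)
  show "norm (c *\<^sub>C x) \<le> norm x * cmod c" for x :: 'a
    by (simp add: norm_scaleC)
qed

text \<open>Since Re (-i z) = Im z, the imaginary part is again a real inner product. This splits a
  complex rank-one map into two real ones, for which boundedness is automatic.\<close>

lemma cinner_eq_inner: "cinner x y = complex_of_real (x \<bullet> y) + \<i> * complex_of_real (x \<bullet> (\<i> *\<^sub>C y))"
  by (simp add: inner_eq_Re_cinner complex_eq_iff cinner_scaleC_right)

lemma rank_one_operator:
  fixes u v :: "'a::complex_inner"
  obtains T :: "'a \<Rightarrow>\<^sub>L 'a" where "bounded_op T" "\<And>z. blinfun_apply T z = cinner z v *\<^sub>C u"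
proof -
  have *: "cinner z v *\<^sub>C u = (z \<bullet> v) *\<^sub>R u + (z \<bullet> (\<i> *\<^sub>C v)) *\<^sub>R (\<i> *\<^sub>C u)" for z
    unfolding cinner_eq_inner[of z v] scaleC_add_left
    by (simp add: scaleC_of_real[symmetric] scaleC_scaleC mult.commute)
  have "bounded_linear (\<lambda>z. cinner z v *\<^sub>C u)"
    unfolding * by (intro bounded_linear_intros)
  then have ap: "blinfun_apply (Blinfun (\<lambda>z. cinner z v *\<^sub>C u)) z = cinner z v *\<^sub>C u" for z
    by (simp add: bounded_linear_Blinfun_apply)
  show ?thesis
    by (rule that[OF _ ap]) (simp add: bounded_op_def ap cinner_scaleC_left scaleC_scaleC)
qed

context
  fixes P :: "'a::complex_inner \<Rightarrow>\<^sub>L 'a"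
  assumes P: "is_projection P"
begin

lemma projection_idem [simp]: "blinfun_apply P (blinfun_apply P x) = blinfun_apply P x"
  using P by (metis is_projection_def blinfun_apply_blinfun_compose)

lemma projection_scaleC: "blinfun_apply P (c *\<^sub>C x) = c *\<^sub>C blinfun_apply P x"
  using P by (simp add: is_projection_def bounded_op_def)

lemma projection_cinner: "cinner (blinfun_apply P x) y = cinner x (blinfun_apply P y)"
  using P by (simp add: is_projection_def)

lemma projection_inner: "blinfun_apply P x \<bullet> y = x \<bullet> blinfun_apply P y"
  by (simp add: inner_eq_Re_cinner projection_cinner)

lemma in_range_projection: "x \<in> op_range P \<longleftrightarrow> blinfun_apply P x = x"
  unfolding op_range_def by (auto, metis rangeI)

lemma norm_projection_le: "norm (blinfun_apply P x) \<le> norm x"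
proof -
  have "(norm (blinfun_apply P x))\<^sup>2 = x \<bullet> blinfun_apply P x"
    by (simp add: power2_norm_eq_inner projection_inner)
  also have "\<dots> \<le> norm x * norm (blinfun_apply P x)"
    by (rule norm_cauchy_schwarz)
  finally show ?thesis
    by (cases "blinfun_apply P x = 0") (simp_all add: power2_eq_square)
qed

lemma closed_range_projection: "closed (op_range P)"
proof -
  have "op_range P = {x. blinfun_apply P x = x}"
    using in_range_projection by blast
  then show ?thesis
    by (auto intro!: closed_Collect_eq continuous_intros)
qed

lemma csubspace_range_projection: "csubspace (op_range P)"
  unfolding complex_vector.subspace_def
  by (auto simp: in_range_projection projection_scaleC blinfun.add_right)

end

lemma proj_le_iff:
  "is_projection Q \<Longrightarrow> P \<preceq> Q \<longleftrightarrow> (\<forall>x. blinfun_apply Q (blinfun_apply P x) = blinfun_apply P x)"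
  unfolding proj_le_def by (auto simp: subset_iff in_range_projection) (auto simp: op_range_def)

lemma proj_le_refl [simp]: "P \<preceq> P"
  by (simp add: proj_le_def)

lemma proj_le_trans: "P \<preceq> Q \<Longrightarrow> Q \<preceq> R \<Longrightarrow> P \<preceq> R"
  unfolding proj_le_def by blast

section \<open>Commutative subspace lattices\<close>

locale csl =
  fixes L :: "('a::complex_inner \<Rightarrow>\<^sub>L 'a) set"
  assumes csl: "commutative_subspace_lattice L"
begin

lemma proj: "P \<in> L \<Longrightarrow> is_projection P"
  using csl by (simp add: commutative_subspace_lattice_def)

lemma comm:
  "P \<in> L \<Longrightarrow> Q \<in> L \<Longrightarrow> blinfun_apply P (blinfun_apply Q x) = blinfun_apply Q (blinfun_apply P x)"
proof -
  assume "P \<in> L" "Q \<in> L"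
  then have "P o\<^sub>L Q = Q o\<^sub>L P"
    using csl by (simp add: commutative_subspace_lattice_def)
  then have "blinfun_apply (P o\<^sub>L Q) x = blinfun_apply (Q o\<^sub>L P) x"
    by simp
  then show ?thesis by simp
qed

lemma zero_in: "0 \<in> L"
  using csl by (simp add: commutative_subspace_lattice_def)

lemma le_iff:
  "P \<in> L \<Longrightarrow> Q \<in> L \<Longrightarrow> P \<preceq> Q \<longleftrightarrow> (\<forall>x. blinfun_apply Q (blinfun_apply P x) = blinfun_apply P x)"
  using proj_le_iff proj by blast

lemma antisym:
  assumes "P \<in> L" "Q \<in> L" "P \<preceq> Q" "Q \<preceq> P"
  shows "P = Q"
proof (rule blinfun_eqI)
  show "blinfun_apply P x = blinfun_apply Q x" for x
    using assms comm[of P Q x] by (simp add: le_iff)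
qed

lemma zero_le: "P \<in> L \<Longrightarrow> 0 \<preceq> P"
  by (simp add: proj_le_iff proj)

lemma le_less_trans: "P \<in> L \<Longrightarrow> Q \<in> L \<Longrightarrow> R \<in> L \<Longrightarrow> P \<preceq> Q \<Longrightarrow> Q \<prec> R \<Longrightarrow> P \<prec> R"
  unfolding proj_less_def using antisym proj_le_trans by blast

section \<open>Suprema, infima, and explicit formulas for binary joins and meets\<close>

lemma obtain_Inf:
  assumes "S \<subseteq> L"
  obtains R where "R \<in> L" "op_range R = (\<Inter>P\<in>S. op_range P)"
proof -
  have "\<exists>R\<in>L. op_range R = (\<Inter>P\<in>S. op_range P)"
    using csl assms unfolding commutative_subspace_lattice_def by simp
  then show ?thesis using that by blast
qed

lemma obtain_Sup:
  assumes "S \<subseteq> L"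
  obtains R where "R \<in> L" "\<And>P. P \<in> S \<Longrightarrow> P \<preceq> R"
    "\<And>N. closed N \<Longrightarrow> csubspace N \<Longrightarrow> \<forall>P\<in>S. op_range P \<subseteq> N \<Longrightarrow> op_range R \<subseteq> N"
proof -
  have "\<exists>R\<in>L. op_range R = closure (cspan (\<Union>P\<in>S. op_range P))"
    using csl assms unfolding commutative_subspace_lattice_def by simp
  then obtain R where R: "R \<in> L" "op_range R = closure (cspan (\<Union>P\<in>S. op_range P))"
    by blast
  show ?thesis
  proof (rule that[OF R(1)])
    show "P \<preceq> R" if "P \<in> S" for P
      unfolding proj_le_def R(2)
      using that closure_subset complex_vector.span_superset by fast
    show "op_range R \<subseteq> N" if "closed N" "csubspace N" "\<forall>P\<in>S. op_range P \<subseteq> N" for N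
      unfolding R(2)
      by (intro closure_minimal complex_vector.span_minimal UN_least that) (use that in auto)
  qed
qed

text \<open>The fixed points of J = P + Q - P Q form a closed subspace containing both ranges, so J
  R = R for the closed span R. Since P R = P and Q R = Q, also J R = J.\<close>

lemma obtain_join:
  assumes PQ: "P \<in> L" "Q \<in> L"
  obtains R where "R \<in> L" "P \<preceq> R" "Q \<preceq> R"
    "\<And>x. blinfun_apply R x = blinfun_apply P x + blinfun_apply Q x - blinfun_apply P (blinfun_apply Q x)"
proof -
  obtain R where R: "R \<in> L" and up: "\<And>F. F \<in> {P, Q} \<Longrightarrow> F \<preceq> R"
    and least: "\<And>N. closed N \<Longrightarrow> csubspace N \<Longrightarrow> \<forall>F\<in>{P, Q}. op_range F \<subseteq> N \<Longrightarrow> op_range R \<subseteq> N"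
    by (rule obtain_Sup[of "{P, Q}"]) (use assms in \<open>auto intro: that\<close>)
  define J where "J x = blinfun_apply P x + blinfun_apply Q x - blinfun_apply P (blinfun_apply Q x)" for x
  have "op_range R \<subseteq> {x. J x = x}"
  proof (rule least)
    show "closed {x. J x = x}"
      unfolding J_def by (intro closed_Collect_eq continuous_intros)
    show "csubspace {x. J x = x}"
    proof -
      have "J 0 = 0" "J (x + y) = J x + J y" for x y
        by (simp_all add: J_def blinfun.add_right blinfun.zero_right)
      moreover have "J (c *\<^sub>C x) = c *\<^sub>C J x" for c x
        by (simp add: J_def projection_scaleC[OF proj] PQ scaleC_add_right
            complex_vector.scale_right_diff_distrib)
      ultimately show ?thesis
        unfolding complex_vector.subspace_def by simp
    qed
    show "\<forall>F\<in>{P, Q}. op_range F \<subseteq> {x. J x = x}"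
      using comm[OF PQ] by (auto simp: J_def op_range_def PQ proj)
  qed
  then have "J (blinfun_apply R x) = blinfun_apply R x" for x
    by (auto simp: op_range_def)
  moreover have "J (blinfun_apply R x) = J x" for x
  proof -
    have "blinfun_apply P (blinfun_apply R x) = blinfun_apply P x"
         "blinfun_apply Q (blinfun_apply R x) = blinfun_apply Q x" for x
      using up[of P] up[of Q] R PQ by (auto simp: le_iff comm[of _ R])
    then show ?thesis by (simp add: J_def)
  qed
  ultimately show ?thesis
    by (intro that[OF R]) (auto simp: up J_def)
qed

lemma obtain_meet:
  assumes "P \<in> L" "Q \<in> L"
  obtains R where "R \<in> L" "R \<preceq> P" "R \<preceq> Q" "\<And>x. blinfun_apply R x = blinfun_apply P (blinfun_apply Q x)"
proof -
  obtain R where R: "R \<in> L" "op_range R = op_range P \<inter> op_range Q"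
    using obtain_Inf[of "{P, Q}"] assms by auto
  then have le: "R \<preceq> P" "R \<preceq> Q" by (auto simp: proj_le_def)
  have "blinfun_apply R x = blinfun_apply P (blinfun_apply Q x)" for x
  proof -
    have "blinfun_apply P (blinfun_apply Q x) \<in> op_range R"
      unfolding R(2) using assms by (simp add: in_range_projection proj comm[of Q P])
    then have "blinfun_apply P (blinfun_apply Q x) = blinfun_apply R (blinfun_apply P (blinfun_apply Q x))"
      by (simp add: in_range_projection R(1) proj)
    also have "\<dots> = blinfun_apply P (blinfun_apply Q (blinfun_apply R x))"
      by (simp add: comm[OF R(1) assms(1)] comm[OF R(1) assms(2)])
    also have "\<dots> = blinfun_apply R x"
      using le assms R(1) by (simp add: le_iff)
    finally show ?thesis ..
  qed
  then show ?thesis using that R(1) le by blast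
qed

text \<open>The join formula writes R x as a combination of vectors from the two ranges, so
  \<open>M\<close> only has to be a subspace, not closed.\<close>

lemma range_join_subset:
  assumes "P \<in> L" "Q \<in> L" "op_range P \<subseteq> M" "op_range Q \<subseteq> M" "csubspace M"
  obtains R where "R \<in> L" "P \<preceq> R" "Q \<preceq> R" "op_range R \<subseteq> M"
proof -
  obtain R where R: "R \<in> L" "P \<preceq> R" "Q \<preceq> R"
    "\<And>x. blinfun_apply R x = blinfun_apply P x + blinfun_apply Q x - blinfun_apply P (blinfun_apply Q x)"
    by (rule obtain_join[OF assms(1,2)]) (rule that)
  have "op_range R \<subseteq> M"
    unfolding op_range_def image_subset_iff R(4)
    by (intro ballI complex_vector.subspace_diff complex_vector.subspace_add assms(5))
      (use assms(3,4) in \<open>auto simp: op_range_def\<close>)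
  then show ?thesis by (rule that[OF R(1-3)])
qed

lemma join_least:
  assumes "R \<in> L" "P \<in> L" "Q \<in> L" "G \<in> L" "P \<preceq> G" "Q \<preceq> G"
    and "\<And>x. blinfun_apply R x = blinfun_apply P x + blinfun_apply Q x - blinfun_apply P (blinfun_apply Q x)"
  shows "R \<preceq> G"
  using assms by (simp add: le_iff blinfun.diff_right blinfun.add_right)

section \<open>Atoms\<close>

lemma difference_projection:
  assumes PQ: "P \<in> L" "Q \<in> L" "Q \<preceq> P"
  shows "is_projection (P - Q)"
proof -
  have qp: "blinfun_apply P (blinfun_apply Q x) = blinfun_apply Q x"
           "blinfun_apply Q (blinfun_apply P x) = blinfun_apply Q x" for x
    using PQ by (auto simp: le_iff comm[of Q P])
  have "bounded_op (P - Q)"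
    unfolding bounded_op_def
    by (auto simp: blinfun.diff_left projection_scaleC[OF proj] PQ complex_vector.scale_right_diff_distrib)
  moreover have "(P - Q) o\<^sub>L (P - Q) = P - Q"
    by (rule blinfun_eqI) (simp add: blinfun.diff_left blinfun.diff_right qp proj PQ(1,2))
  moreover have "cinner (blinfun_apply (P - Q) x) y = cinner x (blinfun_apply (P - Q) y)" for x y
  proof -
    have add: "cinner (a - b) c = cinner a c - cinner b c" for a b c :: 'a
      using cinner_add_left[of "a - b" b c] by simp
    then have "cinner a (b - c) = cinner a b - cinner a c" for a b c :: 'a
      by (metis cinner_commute complex_cnj_diff)
    then show ?thesis
      by (simp add: blinfun.diff_left add projection_cinner[OF proj[OF PQ(1)]]
          projection_cinner[OF proj[OF PQ(2)]])
  qed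
  ultimately show ?thesis by (simp add: is_projection_def)
qed

lemma atom_projection:
  assumes "atom_from L A"
  shows "is_projection A" "A \<noteq> 0"
  using assms difference_projection unfolding atom_from_def proj_less_def by auto

lemma atom_comm:
  assumes "atom_from L A" "F \<in> L"
  shows "blinfun_apply A (blinfun_apply F x) = blinfun_apply F (blinfun_apply A x)"
  using assms unfolding atom_from_def
  by (auto simp: blinfun.diff_left blinfun.diff_right comm)

lemma atom_le_iff:
  assumes "atom_from L A" "F \<in> L"
  shows "A \<preceq> F \<longleftrightarrow> A o\<^sub>L F = A"
proof -
  have "A \<preceq> F \<longleftrightarrow> (\<forall>x. blinfun_apply (A o\<^sub>L F) x = blinfun_apply A x)"
    using assms(2) by (simp add: proj_le_iff proj atom_comm[OF assms])
  then show ?thesis by (metis blinfun_eqI)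
qed

text \<open>Each element of \<open>L\<close> thus either contains the atom or is orthogonal to it;
  this dichotomy puts the rank-one operators below into \<open>Alg L\<close>.\<close>

lemma atom_not_le:
  assumes "atom_from L A" "F \<in> L" "\<not> A \<preceq> F"
  shows "blinfun_apply A (blinfun_apply F x) = 0"
proof -
  have "A o\<^sub>L F = 0"
    using assms atom_le_iff[OF assms(1,2)] by (auto simp: atom_from_def)
  then have "blinfun_apply (A o\<^sub>L F) x = 0" by simp
  then show ?thesis by simp
qed

lemma atom_cover:
  assumes A: "atom_from L A"
  obtains E where "E \<in> L" "A \<preceq> E" "\<And>F. F \<in> L \<Longrightarrow> A \<preceq> F \<Longrightarrow> E \<preceq> F"
proof -
  obtain E where E: "E \<in> L" "op_range E = (\<Inter>P\<in>{F\<in>L. A \<preceq> F}. op_range P)"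
    using obtain_Inf[of "{F\<in>L. A \<preceq> F}"] by auto
  show ?thesis
    by (rule that[OF E(1)]) (use E(2) in \<open>auto simp: proj_le_def\<close>)
qed

text \<open>An element F of \<open>L\<close> cuts the interval at the join of Q with the meet of P
  and F, and this join minus Q equals (P - Q) F. By minimality the join is Q or P, so the product is
  0 or P - Q.\<close>

lemma minimal_interval_atom:
  assumes "P \<in> L" "Q \<in> L" "Q \<prec> P" and min: "\<And>F. F \<in> L \<Longrightarrow> Q \<prec> F \<Longrightarrow> F \<preceq> P \<Longrightarrow> F = P"
  shows "atom_from L (P - Q)"
proof -
  have qp: "blinfun_apply P (blinfun_apply Q x) = blinfun_apply Q x"
           "blinfun_apply Q (blinfun_apply P x) = blinfun_apply Q x" for x
    using assms(1-3) unfolding proj_less_def by (auto simp: le_iff comm[of Q P])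
  have "(P - Q) o\<^sub>L F = 0 \<or> (P - Q) o\<^sub>L F = P - Q" if F: "F \<in> L" for F
  proof -
    obtain G where G: "G \<in> L" "G \<preceq> P" "\<And>x. blinfun_apply G x = blinfun_apply P (blinfun_apply F x)"
      by (rule obtain_meet[OF assms(1) F]) (rule that)
    obtain R where R: "R \<in> L" "Q \<preceq> R"
      "\<And>x. blinfun_apply R x = blinfun_apply Q x + blinfun_apply G x - blinfun_apply Q (blinfun_apply G x)"
      by (rule obtain_join[OF assms(2) G(1)]) (rule that)
    have "R \<preceq> P"
      using join_least[OF R(1) assms(2) G(1) assms(1) _ G(2) R(3)] assms(3) by (simp add: proj_less_def)
    moreover have eq: "blinfun_apply R x - blinfun_apply Q x = blinfun_apply ((P - Q) o\<^sub>L F) x" for x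
      by (simp add: R(3) G(3) qp blinfun.diff_left)
    ultimately have "R = Q \<or> R = P"
      using min R by (auto simp: proj_less_def)
    then show ?thesis
    proof
      assume "R = Q"
      then show ?thesis using eq by (auto intro!: blinfun_eqI)
    next
      assume "R = P"
      then show ?thesis using eq by (intro disjI2 blinfun_eqI) (simp add: blinfun.diff_left)
    qed
  qed
  then show ?thesis using assms(1-3) unfolding atom_from_def by blast
qed

text \<open>Take T z = <z, A x> u with u in the range of E. If A lies under F, then so does E, hence
  F u = u; otherwise A F = 0, so T vanishes on the range of F. Finally T x is u times <x, A x>,
  which equals the nonzero <A x, A x>.\<close>

lemma atom_rank_one:
  assumes A: "atom_from L A" and E: "E \<in> L" "\<And>F. F \<in> L \<Longrightarrow> A \<preceq> F \<Longrightarrow> E \<preceq> F"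
    and M: "invariant_manifold L M" and x: "x \<in> M" "blinfun_apply A x \<noteq> 0"
  shows "op_range E \<subseteq> M"
proof
  fix u assume u: "u \<in> op_range E"
  let ?v = "blinfun_apply A x"
  define c where "c = cinner ?v ?v"
  have c: "c \<noteq> 0" using cinner_self_nonzero x unfolding c_def by blast
  note projA = atom_projection(1)[OF A]
  obtain T where T: "bounded_op T" "\<And>z. blinfun_apply T z = cinner z ?v *\<^sub>C u"
    using rank_one_operator by blast
  have "T o\<^sub>L F = F o\<^sub>L T o\<^sub>L F" if F: "F \<in> L" for F
  proof (cases "A \<preceq> F")
    case True
    then have "blinfun_apply F u = u"
      using E(2)[OF F] u F in_range_projection[OF proj[OF F]] by (auto simp: proj_le_def)
    then show ?thesis
      by (intro blinfun_eqI) (simp add: T(2) projection_scaleC proj F)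
  next
    case False
    have "cinner (blinfun_apply F z) ?v = 0" for z
    proof -
      have "cinner (blinfun_apply F z) ?v = cinner (blinfun_apply A (blinfun_apply F z)) x"
        by (simp add: projection_cinner[OF projA])
      also have "\<dots> = 0"
        using atom_not_le[OF A F False] cinner_scaleC_left[of 0 0 x] by simp
      finally show ?thesis .
    qed
    then show ?thesis
      by (intro blinfun_eqI) (simp add: T(2) blinfun.zero_right)
  qed
  then have "T \<in> Alg L" using T(1) by (simp add: Alg_def)
  then have "blinfun_apply T x \<in> M" using M x by (auto simp: invariant_manifold_def)
  moreover have "blinfun_apply T x = c *\<^sub>C u"
    unfolding T(2) c_def by (simp add: projection_cinner[OF projA] projection_idem[OF projA])
  ultimately have "inverse c *\<^sub>C c *\<^sub>C u \<in> M"
    using M complex_vector.subspace_scale unfolding invariant_manifold_def by metis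
  then show "u \<in> M"
    using c by (simp add: scaleC_scaleC)
qed

section \<open>The ascending chain condition\<close>

text \<open>The larger projection comes first, so well-foundedness excludes infinite strict ascent,
  and minimal elements for this relation are maximal projections.\<close>

definition above :: "(('a \<Rightarrow>\<^sub>L 'a) \<times> ('a \<Rightarrow>\<^sub>L 'a)) set" where
  "above = {(Q, P). P \<in> L \<and> Q \<in> L \<and> P \<prec> Q}"

lemma ascending_mono:
  assumes "\<And>n. F n \<preceq> F (Suc n)" "m \<le> n"
  shows "F m \<preceq> F n"
  using assms(2)
proof (induction rule: dec_induct)
  case (step n)
  show ?case by (rule proj_le_trans[OF step.IH assms(1)])
qed simp

lemma ascending_stabilizes_iff_wf: "ascending_stabilizes L \<longleftrightarrow> wf above"
proof
  assume acc: "ascending_stabilizes L"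
  have False if F: "\<And>i. (F (Suc i), F i) \<in> above" for F
  proof -
    have "(\<forall>n. F n \<in> L) \<and> (\<forall>n. F n \<preceq> F (Suc n))" and ne: "F n \<noteq> F (Suc n)" for n
      using F unfolding above_def proj_less_def by auto
    then obtain N where "\<forall>n\<ge>N. F n = F N"
      using acc unfolding ascending_stabilizes_def by blast
    then show False using ne[of N] by (metis le_Suc_eq order_refl)
  qed
  then show "wf above" unfolding wf_iff_no_infinite_down_chain by blast
next
  assume wf: "wf above"
  show "ascending_stabilizes L"
    unfolding ascending_stabilizes_def
  proof (intro allI impI, elim conjE)
    fix F assume F: "\<forall>n. F n \<in> L" "\<forall>n. F n \<preceq> F (Suc n)"
    obtain P where P: "P \<in> range F" "\<And>y. (y, P) \<in> above \<Longrightarrow> y \<notin> range F"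
      by (rule wfE_min[OF wf rangeI]) (rule that)
    then obtain N where "\<And>n. (F n, F N) \<notin> above"
      by blast
    moreover have "F N \<preceq> F n" if "n \<ge> N" for n
      using ascending_mono[of F N n] F that by blast
    ultimately have "F n = F N" if "n \<ge> N" for n
      using F(1) that by (fastforce simp: above_def proj_less_def)
    then show "\<exists>N. \<forall>n\<ge>N. F n = F N" by blast
  qed
qed

lemma obtain_maximal:
  assumes "wf above" "S \<subseteq> L" "P \<in> S"
  obtains Q where "Q \<in> S" "\<And>R. R \<in> S \<Longrightarrow> Q \<preceq> R \<Longrightarrow> R = Q"
proof -
  obtain Q where Q: "Q \<in> S" "\<And>R. (R, Q) \<in> above \<Longrightarrow> R \<notin> S"
    by (rule wfE_min[OF assms(1,3)]) (rule that)
  show ?thesis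
  proof (rule that[OF Q(1)])
    show "R = Q" if "R \<in> S" "Q \<preceq> R" for R
      using Q(1) Q(2)[of R] assms(2) that by (auto simp: above_def proj_less_def)
  qed
qed

text \<open>Choose Q maximal among the elements above P and strictly below R. Nothing of
  \<open>L\<close> then fits between Q and R, which yields both the atom and, with P = 0, the
  immediate predecessor needed for nests.\<close>

lemma obtain_atom_between:
  assumes "wf above" "P \<in> L" "R \<in> L" "P \<prec> R"
  obtains Q where "Q \<in> L" "P \<preceq> Q" "Q \<prec> R" "atom_from L (R - Q)" "\<not> (\<exists>F\<in>L. Q \<prec> F \<and> F \<prec> R)"
proof -
  define S where "S = {Q\<in>L. P \<preceq> Q \<and> Q \<prec> R}"
  have "S \<subseteq> L" "P \<in> S"
    using assms(2,4) by (auto simp: S_def)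
  then obtain Q where "Q \<in> S" and max: "\<And>F. F \<in> S \<Longrightarrow> Q \<preceq> F \<Longrightarrow> F = Q"
    by (rule obtain_maximal[OF assms(1)]) (rule that)
  then have Q: "Q \<in> L" "P \<preceq> Q" "Q \<prec> R" by (auto simp: S_def)
  have max': "F = R" if F: "F \<in> L" "Q \<prec> F" "F \<preceq> R" for F
  proof (rule ccontr)
    assume "F \<noteq> R"
    moreover have "P \<preceq> F" "Q \<preceq> F"
      using F(2) proj_le_trans[OF Q(2), of F] by (simp_all add: proj_less_def)
    ultimately have "F = Q"
      using F by (intro max) (simp_all add: S_def proj_less_def)
    then show False using F(2) by (simp add: proj_less_def)
  qed
  show ?thesis
  proof (rule that[OF Q minimal_interval_atom[OF assms(3) Q(1,3) max']])
    show "\<not> (\<exists>F\<in>L. Q \<prec> F \<and> F \<prec> R)" using max' by (auto simp: proj_less_def)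
  qed
qed

text \<open>\<open>R - Q\<close> is orthogonal to \<open>Q\<close>, so containment would force R =
  Q. Both maximality arguments below end in this contradiction.\<close>

lemma atom_difference_not_le:
  assumes "Q \<in> L" "Q \<prec> R" "R \<in> L"
  shows "\<not> R - Q \<preceq> Q"
proof
  assume "R - Q \<preceq> Q"
  then have "blinfun_apply Q (blinfun_apply R x - blinfun_apply Q x) = blinfun_apply R x - blinfun_apply Q x" for x
    using assms by (simp add: proj_le_iff proj blinfun.diff_left)
  moreover have "blinfun_apply Q (blinfun_apply R x) = blinfun_apply Q x" for x
    using assms unfolding proj_less_def by (simp add: le_iff comm[of Q R])
  ultimately have "R = Q"
    using assms by (intro blinfun_eqI) (simp add: blinfun.diff_right proj)
  then show False using assms(2) by (simp add: proj_less_def)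
qed

lemma difference_le:
  assumes "Q \<in> L" "Q \<prec> R" "R \<in> L"
  shows "R - Q \<preceq> R"
  using assms by (auto simp: proj_le_iff proj proj_less_def blinfun.diff_left blinfun.diff_right)

section \<open>Hyperatomic lattices and the ascending chain condition\<close>

lemma wf_imp_hyperatomic:
  assumes wf: "wf above"
  shows "hyperatomic L"
  unfolding hyperatomic_def
proof (intro ballI impI)
  fix P assume P: "P \<in> L"
  \<comment> \<open>These are the finitely generated elements below P; 0 is one of them, generated
    by no atoms. A maximal one must be P: otherwise an atom P - Q with Q above it can be adjoined to
    the generators, and joining with the cover of that atom gives a larger element.\<close>
  define fg where "fg = {P'\<in>L. P' \<preceq> P \<and> (\<exists>S. finite S \<and> (\<forall>A\<in>S. atom_from L A) \<and> generated_by L S P')}"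
  have "fg \<subseteq> L" by (auto simp: fg_def)
  moreover have "0 \<in> fg"
    unfolding fg_def generated_by_def using zero_in zero_le P by (auto intro!: exI[of _ "{}"])
  ultimately obtain P' where P': "P' \<in> fg" and max: "\<And>R. R \<in> fg \<Longrightarrow> P' \<preceq> R \<Longrightarrow> R = P'"
    by (rule obtain_maximal[OF wf]) (rule that)
  obtain S where S: "finite S" "\<forall>A\<in>S. atom_from L A" "generated_by L S P'"
    and P'L: "P' \<in> L" "P' \<preceq> P"
    using P' unfolding fg_def by blast
  have "P' = P"
  proof (rule ccontr)
    assume "P' \<noteq> P"
    then have "P' \<prec> P" using P'L by (simp add: proj_less_def)
    then obtain Q where Q: "Q \<in> L" "P' \<preceq> Q" "Q \<prec> P" "atom_from L (P - Q)"
      by (rule obtain_atom_between[OF wf P'L(1) P]) (rule that)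
    obtain E where E: "E \<in> L" "P - Q \<preceq> E" "\<And>F. F \<in> L \<Longrightarrow> P - Q \<preceq> F \<Longrightarrow> E \<preceq> F"
      by (rule atom_cover[OF Q(4)]) (rule that)
    obtain R where R: "R \<in> L" "P' \<preceq> R" "E \<preceq> R"
      "\<And>x. blinfun_apply R x = blinfun_apply P' x + blinfun_apply E x - blinfun_apply P' (blinfun_apply E x)"
      by (rule obtain_join[OF P'L(1) E(1)]) (rule that)
    have "E \<preceq> P" using E(3)[OF P difference_le[OF Q(1,3) P]] .
    then have "R \<preceq> P"
      by (rule join_least[OF R(1) P'L(1) E(1) P P'L(2) _ R(4)])
    moreover have "generated_by L (insert (P - Q) S) R"
      unfolding generated_by_def
    proof (intro conjI ballI impI)
      show "A \<preceq> R" if "A \<in> insert (P - Q) S" for A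
        using that proj_le_trans[OF E(2) R(3)] proj_le_trans[of A P' R] R(2) S(3)
        by (auto simp: generated_by_def)
      show "R \<preceq> F" if "F \<in> L" "\<forall>A\<in>insert (P - Q) S. A \<preceq> F" for F
        using that S(3) E(3) by (intro join_least[OF R(1) P'L(1) E(1) that(1) _ _ R(4)])
          (auto simp: generated_by_def)
    qed (rule R(1))
    ultimately have "R \<in> fg"
      unfolding fg_def using S Q(4) R(1) by (auto intro!: exI[of _ "insert (P - Q) S"])
    then have "R = P'" using max R by blast
    then have "P - Q \<preceq> Q"
      using proj_le_trans[OF proj_le_trans[OF E(2) R(3)]] Q(2) by simp
    then show False using atom_difference_not_le[OF Q(1,3) P] by simp
  qed
  then show "\<exists>S. finite S \<and> (\<forall>A\<in>S. atom_from L A) \<and> generated_by L S P"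
    using S by blast
qed

lemma obtain_Sup_sequence:
  fixes F :: "nat \<Rightarrow> 'a \<Rightarrow>\<^sub>L 'a"
  assumes "\<And>n. F n \<in> L"
  obtains P where "P \<in> L" "\<And>n. F n \<preceq> P"
    "\<And>N. closed N \<Longrightarrow> csubspace N \<Longrightarrow> \<forall>n. op_range (F n) \<subseteq> N \<Longrightarrow> op_range P \<subseteq> N"
proof -
  have "range F \<subseteq> L" using assms by auto
  then obtain P where P: "P \<in> L" "\<And>Q. Q \<in> range F \<Longrightarrow> Q \<preceq> P"
    "\<And>N. closed N \<Longrightarrow> csubspace N \<Longrightarrow> \<forall>Q\<in>range F. op_range Q \<subseteq> N \<Longrightarrow> op_range P \<subseteq> N"
    by (rule obtain_Sup) (rule that)
  show ?thesis
    by (rule that[OF P(1) P(2)[OF rangeI] P(3)]) auto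
qed

text \<open>An atom A under the supremum P must lie under some F n. Otherwise every F n is contained
  in the kernel of A, a closed subspace, which then contains P as well, and A = A A = 0. The
  finitely many atoms generating P therefore already lie under a single F N.\<close>

lemma hyperatomic_imp_ascending_stabilizes:
  assumes hyp: "hyperatomic L"
  shows "ascending_stabilizes L"
  unfolding ascending_stabilizes_def
proof (intro allI impI, elim conjE)
  fix F assume "\<forall>n. F n \<in> L" "\<forall>n. F n \<preceq> F (Suc n)"
  then have F: "F n \<in> L" "F n \<preceq> F (Suc n)" for n by simp_all
  note mono = ascending_mono[of F, OF F(2)]
  obtain P where P: "P \<in> L" "\<And>n. F n \<preceq> P"
    and least: "\<And>N. closed N \<Longrightarrow> csubspace N \<Longrightarrow> \<forall>n. op_range (F n) \<subseteq> N \<Longrightarrow> op_range P \<subseteq> N"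
    by (rule obtain_Sup_sequence[of F, OF F(1)]) (rule that)
  have "\<exists>N. P \<preceq> F N"
  proof (cases "P = 0")
    case True
    then show ?thesis using zero_le[OF F(1)] by blast
  next
    case False
    then have "\<exists>S. finite S \<and> (\<forall>A\<in>S. atom_from L A) \<and> generated_by L S P"
      using hyp P(1) by (simp add: hyperatomic_def)
    then obtain S where S: "finite S" "\<And>A. A \<in> S \<Longrightarrow> atom_from L A" "generated_by L S P"
      by blast
    have "\<exists>n. A \<preceq> F n" if A: "A \<in> S" for A
    proof (rule ccontr)
      assume n: "\<nexists>n. A \<preceq> F n"
      note at = S(2)[OF A]
      have "op_range P \<subseteq> {x. blinfun_apply A x = 0}"
      proof (rule least)
        show "closed {x. blinfun_apply A x = 0}"
          by (intro closed_Collect_eq continuous_intros)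
        show "csubspace {x. blinfun_apply A x = 0}"
          unfolding complex_vector.subspace_def
          by (auto simp: blinfun.add_right blinfun.zero_right projection_scaleC[OF atom_projection(1)[OF at]])
        show "\<forall>n. op_range (F n) \<subseteq> {x. blinfun_apply A x = 0}"
          using atom_not_le[OF at F(1)] n by (auto simp: op_range_def)
      qed
      moreover have "A \<preceq> P" using S(3) A by (simp add: generated_by_def)
      ultimately have "blinfun_apply A (blinfun_apply A x) = 0" for x
        by (auto simp: proj_le_def op_range_def)
      then have "A = 0"
        using projection_idem[OF atom_projection(1)[OF at]] by (intro blinfun_eqI) simp
      then show False using atom_projection(2)[OF at] by blast
    qed
    then obtain n where n: "\<And>A. A \<in> S \<Longrightarrow> A \<preceq> F (n A)" by metis
    \<comment> \<open>Finiteness of \<open>S\<close> provides one index for all atoms.\<close>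
    obtain N where N: "\<And>A. A \<in> S \<Longrightarrow> n A \<le> N"
      using S(1) by (metis finite_imageI finite_nat_set_iff_bounded_le imageI)
    have "A \<preceq> F N" if "A \<in> S" for A
      by (rule proj_le_trans[OF n[OF that] mono[OF N[OF that]]])
    then have "P \<preceq> F N"
      using S(3) F(1) by (simp add: generated_by_def)
    then show ?thesis ..
  qed
  then obtain N where N: "P \<preceq> F N" ..
  have "F n = F N" if "n \<ge> N" for n
    using antisym[OF F(1) F(1)] proj_le_trans[OF P(2) N] mono[OF that] by blast
  then show "\<exists>N. \<forall>n\<ge>N. F n = F N" by blast
qed

text \<open>
  The largest \<open>P \<in> L\<close> whose range lies in \<open>M\<close> must be all of \<open>M\<close>: a vector of \<open>M\<close> outside it would
  be seen by some atom \<open>A\<close> lying above \<open>P\<close>, and the rank-one operators of \<open>Alg L\<close> supported on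
  \<open>A\<close> would then enlarge \<open>P\<close>.
\<close>

lemma wf_imp_invariant_manifold_in:
  assumes wf: "wf above" and M: "invariant_manifold L M"
  shows "\<exists>P\<in>L. op_range P = M"
proof -
  have sub: "csubspace M" using M by (simp add: invariant_manifold_def)
  define S where "S = {P\<in>L. op_range P \<subseteq> M}"
  have "S \<subseteq> L" "0 \<in> S"
    using zero_in complex_vector.subspace_0[OF sub] by (auto simp: S_def op_range_def)
  then obtain P where "P \<in> S" and max: "\<And>R. R \<in> S \<Longrightarrow> P \<preceq> R \<Longrightarrow> R = P"
    by (rule obtain_maximal[OF wf]) (rule that)
  then have P: "P \<in> L" "op_range P \<subseteq> M" by (auto simp: S_def)
  have "x \<in> op_range P" if x: "x \<in> M" for x
  proof (rule ccontr)
    assume nx: "x \<notin> op_range P"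
    \<comment> \<open>R is the least element of \<open>L\<close> above P whose range contains x. Any
      Q above P and strictly below R therefore misses x, so the atom R - Q does not annihilate
      x.\<close>
    obtain R where R: "R \<in> L" "op_range R = (\<Inter>F\<in>{F\<in>L. P \<preceq> F \<and> x \<in> op_range F}. op_range F)"
      using obtain_Inf[of "{F\<in>L. P \<preceq> F \<and> x \<in> op_range F}"] by auto
    then have "P \<preceq> R" and xR: "x \<in> op_range R" by (auto simp: proj_le_def)
    then have "P \<prec> R" using nx by (auto simp: proj_less_def)
    then obtain Q where Q: "Q \<in> L" "P \<preceq> Q" "Q \<prec> R" "atom_from L (R - Q)"
      by (rule obtain_atom_between[OF wf P(1) R(1)]) (rule that)
    have "x \<notin> op_range Q"
    proof
      assume "x \<in> op_range Q"
      then have "R \<preceq> Q" using Q R(2) by (auto simp: proj_le_def)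
      then show False using Q(3) antisym[OF R(1) Q(1)] by (auto simp: proj_less_def)
    qed
    then have Ax: "blinfun_apply (R - Q) x \<noteq> 0"
      using xR Q(1) R(1) by (auto simp: in_range_projection proj blinfun.diff_left)
    obtain E where E: "E \<in> L" "R - Q \<preceq> E" "\<And>F. F \<in> L \<Longrightarrow> R - Q \<preceq> F \<Longrightarrow> E \<preceq> F"
      by (rule atom_cover[OF Q(4)]) (rule that)
    have "op_range E \<subseteq> M" using atom_rank_one[OF Q(4) E(1,3) M x Ax] by blast
    then obtain G where G: "G \<in> L" "P \<preceq> G" "E \<preceq> G" "op_range G \<subseteq> M"
      by (rule range_join_subset[OF P(1) E(1) P(2) _ sub]) (rule that)
    then have "G = P" by (intro max) (simp_all add: S_def)
    then have "E \<preceq> P" using G(3) by simp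
    then have "R - Q \<preceq> Q" using proj_le_trans[OF proj_le_trans[OF E(2)] Q(2)] by blast
    then show False using atom_difference_not_le[OF Q(1,3) R(1)] by simp
  qed
  then show ?thesis using P by blast
qed

section \<open>Immediate predecessors in a nest\<close>

lemma nest_predecessor_iff:
  assumes "nest L"
  shows "wf above \<longleftrightarrow> (\<forall>P\<in>L. P \<noteq> 0 \<longrightarrow> has_immediate_predecessor L P)"
proof
  assume wf: "wf above"
  show "\<forall>P\<in>L. P \<noteq> 0 \<longrightarrow> has_immediate_predecessor L P"
  proof (intro ballI impI)
    fix P assume P: "P \<in> L" "P \<noteq> 0"
    then have "0 \<prec> P" using zero_le by (auto simp: proj_less_def)
    then obtain Q where "Q \<in> L" "Q \<prec> P" "\<not> (\<exists>F\<in>L. Q \<prec> F \<and> F \<prec> P)"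
      by (rule obtain_atom_between[OF wf zero_in P(1)]) (rule that)
    then show "has_immediate_predecessor L P"
      by (auto simp: has_immediate_predecessor_def)
  qed
next
  assume pre: "\<forall>P\<in>L. P \<noteq> 0 \<longrightarrow> has_immediate_predecessor L P"
  have False if chain: "\<And>i. (F (Suc i), F i) \<in> above" for F
  proof -
    have F: "F n \<in> L" "F n \<prec> F (Suc n)" for n
      using chain by (auto simp: above_def)
    \<comment> \<open>The supremum of a strictly ascending sequence cannot have an immediate
      predecessor Q: in a nest an F n not under Q would lie strictly between Q and P, and if all F n
      lie under Q then so does P.\<close>
    obtain P where P: "P \<in> L" "\<And>n. F n \<preceq> P"
      and least: "\<And>N. closed N \<Longrightarrow> csubspace N \<Longrightarrow> \<forall>n. op_range (F n) \<subseteq> N \<Longrightarrow> op_range P \<subseteq> N"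
      by (rule obtain_Sup_sequence[of F, OF F(1)]) (rule that)
    have lt: "F n \<prec> P" for n
      using F(2)[of n] P(2)[of "Suc n"] P(2)[of n] antisym[OF F(1) F(1), of n "Suc n"]
      by (auto simp: proj_less_def)
    then have "P \<noteq> 0"
      using zero_le[OF F(1)] antisym[OF F(1) zero_in] by (auto simp: proj_less_def)
    then obtain Q where Q: "Q \<in> L" "Q \<prec> P" and no: "\<And>G. G \<in> L \<Longrightarrow> Q \<prec> G \<Longrightarrow> \<not> G \<prec> P"
      using pre P(1) by (auto simp: has_immediate_predecessor_def)
    have "F n \<preceq> Q" for n
    proof -
      have "F n \<preceq> Q \<or> Q \<preceq> F n" using assms F(1) Q(1) by (simp add: nest_def)
      then show ?thesis using no[OF F(1), of n] lt[of n] by (auto simp: proj_less_def)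
    qed
    then have "P \<preceq> Q"
      unfolding proj_le_def
      by (intro least closed_range_projection csubspace_range_projection proj Q(1))
        (simp add: proj_le_def)
    then show False using Q(2) antisym[OF P(1) Q(1)] by (auto simp: proj_less_def)
  qed
  then show "wf above" unfolding wf_iff_no_infinite_down_chain by blast
qed

end

section \<open>Invariant operator ranges from strictly ascending sequences\<close>

text \<open>Starting at 0 makes the sum of the first n differences equal to \<open>F n\<close>
  itself; strictness makes every difference nonzero.\<close>

locale csl_chain = csl L for L :: "('a::chilbert_space \<Rightarrow>\<^sub>L 'a) set" +
  fixes F :: "nat \<Rightarrow> 'a \<Rightarrow>\<^sub>L 'a"
  assumes F_in: "F n \<in> L" and F_0: "F 0 = 0" and F_less: "F n \<prec> F (Suc n)"
begin

definition D :: "nat \<Rightarrow> 'a \<Rightarrow>\<^sub>L 'a" where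
  "D k = F (Suc k) - F k"

lemma F_mono: "m \<le> n \<Longrightarrow> F m \<preceq> F n"
  using F_less by (intro ascending_mono[of F m n]) (simp_all add: proj_less_def)

lemma F_F: "m \<le> n \<Longrightarrow> blinfun_apply (F m) (blinfun_apply (F n) x) = blinfun_apply (F m) x"
  using F_mono[of m n] by (simp add: le_iff F_in comm[OF F_in F_in, of m n])

lemma F_F': "m \<le> n \<Longrightarrow> blinfun_apply (F n) (blinfun_apply (F m) x) = blinfun_apply (F m) x"
  using F_F[of m n x] comm[OF F_in F_in, of n m x] by simp

lemma projection_D: "is_projection (D k)"
  unfolding D_def by (intro difference_projection F_in F_mono) simp

lemma norm_D_le: "norm (blinfun_apply (D k) x) \<le> norm x"
  by (rule norm_projection_le[OF projection_D])

lemma D_D: "j \<noteq> k \<Longrightarrow> blinfun_apply (D j) (blinfun_apply (D k) x) = 0"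
  by (cases j k rule: linorder_cases)
    (auto simp: D_def blinfun.diff_left blinfun.diff_right F_F F_F')

lemma D_F: "n \<le> k \<Longrightarrow> blinfun_apply (D k) (blinfun_apply (F n) x) = 0"
  by (simp add: D_def blinfun.diff_left F_F')

lemma sum_D: "(\<Sum>k<n. blinfun_apply (D k) x) = blinfun_apply (F n) x"
  using sum_lessThan_telescope[of "\<lambda>k. blinfun_apply (F k) x" n]
  by (simp add: D_def blinfun.diff_left F_0)

lemma norm_sum_D:
  assumes "finite J" "\<And>j. blinfun_apply (D j) (z j) = z j"
  shows "(norm (sum z J))\<^sup>2 = (\<Sum>j\<in>J. (norm (z j))\<^sup>2)"
proof (rule norm_sum_Pythagorean[OF assms(1)])
  have "z i \<bullet> z j = 0" if "i \<noteq> j" for i j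
  proof -
    have "z i \<bullet> z j = blinfun_apply (D i) (z i) \<bullet> blinfun_apply (D j) (z j)"
      by (simp only: assms(2))
    then show ?thesis
      by (simp add: projection_inner[OF projection_D] D_D[OF that])
  qed
  then show "pairwise (\<lambda>i j. orthogonal (z i) (z j)) J"
    by (simp add: pairwise_def orthogonal_def)
qed

lemma Bessel: "(\<Sum>k<n. (norm (blinfun_apply (D k) x))\<^sup>2) \<le> (norm x)\<^sup>2"
proof -
  have "(\<Sum>k<n. (norm (blinfun_apply (D k) x))\<^sup>2) = (norm (blinfun_apply (F n) x))\<^sup>2"
    by (subst norm_sum_D[symmetric]) (simp_all add: sum_D projection_idem projection_D)
  also have "\<dots> \<le> (norm x)\<^sup>2"
    by (intro power_mono norm_projection_le proj F_in) simp
  finally show ?thesis .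
qed

lemma summable_D: "summable (\<lambda>k. (norm (blinfun_apply (D k) x))\<^sup>2)"
  using Bessel by (intro summableI_nonneg_bounded) auto

text \<open>Orthogonal series need not converge absolutely. Pythagoras instead identifies the
  squared norm of a block of terms with a block of the series of squares, and completeness does the
  rest.\<close>

lemma summable_orthogonal:
  assumes z: "\<And>j. blinfun_apply (D j) (z j) = z j" and "summable (\<lambda>k. (norm (z k))\<^sup>2)"
  shows "summable z"
  unfolding summable_Cauchy
proof (intro allI impI)
  fix e :: real assume "e > 0"
  then obtain N where N: "\<And>m n. m \<ge> N \<Longrightarrow> norm (\<Sum>k=m..<n. (norm (z k))\<^sup>2) < e\<^sup>2"
    using assms(2) unfolding summable_Cauchy by (metis zero_less_power)
  have "norm (sum z {m..<n}) < e" if "m \<ge> N" for m n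
  proof -
    have "(norm (sum z {m..<n}))\<^sup>2 < e\<^sup>2"
      using N[OF that, of n] by (simp add: norm_sum_D z sum_nonneg)
    then show ?thesis using \<open>e > 0\<close> by (simp add: power_less_imp_less_base)
  qed
  then show "\<exists>N. \<forall>m\<ge>N. \<forall>n. norm (sum z {m..<n}) < e" by blast
qed

lemma D_sums:
  assumes z: "\<And>j. blinfun_apply (D j) (z j) = z j" and s: "z sums s"
  shows "blinfun_apply (D k) s = z k"
proof -
  have "(\<lambda>j. blinfun_apply (D k) (z j)) sums blinfun_apply (D k) s"
    by (intro bounded_linear.sums[OF _ s] bounded_linear_intros)
  moreover have "blinfun_apply (D k) (z j) = (if j = k then z j else 0)" for j
    using D_D[of k j "z j"] z[of j] by auto
  ultimately have "(\<lambda>j. if j = k then z j else 0) sums blinfun_apply (D k) s"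
    by simp
  then show ?thesis
    using sums_single by (rule sums_unique2)
qed

text \<open>The invariance proof needs square summable ratios of consecutive weights; a geometric
  bound on the ratios is a convenient way to have them.\<close>

definition weight :: "(nat \<Rightarrow> real) \<Rightarrow> bool" where
  "weight w \<longleftrightarrow> (\<forall>k. 0 < w k \<and> w (Suc k) \<le> (1/2) ^ k * w k)"

definition weighted :: "(nat \<Rightarrow> real) \<Rightarrow> 'a \<Rightarrow>\<^sub>L 'a" where
  "weighted w = (\<Sum>k. w k *\<^sub>R D k)"

section \<open>The diagonal operator \<open>weighted w\<close> and the invariance of its
  range\<close>

context
  fixes w assumes w: "weight w"
begin

lemma weight_pos: "0 < w k" and weight_Suc: "w (Suc k) \<le> (1/2) ^ k * w k"
  using w by (auto simp: weight_def)

lemma weight_antimono: "m \<le> n \<Longrightarrow> w n \<le> w m"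
proof (induction rule: dec_induct)
  case (step n)
  have "(1/2) ^ n * w n \<le> w n"
    using weight_pos[of n] by (simp add: power_le_one mult_left_le_one_le)
  then show ?case using step weight_Suc[of n] by linarith
qed simp

lemma weight_summable: "summable w"
proof (rule summable_ratio_test[of "1/2" 1])
  \<comment> \<open>At index 0 the ratio bound is only 1, so the test starts at 1.\<close>
  fix n :: nat assume "1 \<le> n"
  then have "(1/2) ^ n \<le> (1/2 :: real)"
    using power_decreasing[of 1 n "1/2 :: real"] by simp
  then have "(1/2) ^ n * w n \<le> 1/2 * w n"
    using weight_pos[of n] by (intro mult_right_mono) simp_all
  then have "w (Suc n) \<le> 1/2 * w n"
    using weight_Suc[of n] by linarith
  then show "norm (w (Suc n)) \<le> 1/2 * norm (w n)"
    using weight_pos[of n] weight_pos[of "Suc n"] by simp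
qed simp

lemma weighted_sums: "(\<lambda>k. w k *\<^sub>R blinfun_apply (D k) x) sums blinfun_apply (weighted w) x"
proof -
  have "norm (D k) \<le> 1" for k
    using norm_D_le by (intro norm_blinfun_bound) auto
  then have "norm (w k *\<^sub>R D k) \<le> w k" for k
    using weight_pos[of k] by (simp add: mult_left_le)
  then have "summable (\<lambda>k. w k *\<^sub>R D k)"
    using weight_summable by (rule summable_comparison_test'[of w 0, rotated])
  then have "(\<lambda>k. w k *\<^sub>R D k) sums weighted w"
    unfolding weighted_def by (rule summable_sums)
  then show ?thesis
    using bounded_linear.sums[OF blinfun.bounded_linear_left[of x]]
    by (fastforce simp: blinfun.scaleR_left)
qed

lemma D_weighted: "blinfun_apply (D k) (blinfun_apply (weighted w) x) = w k *\<^sub>R blinfun_apply (D k) x"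
  by (rule D_sums[OF _ weighted_sums]) (simp add: blinfun.scaleR_right projection_idem projection_D)

lemma bounded_op_weighted: "bounded_op (weighted w)"
  unfolding bounded_op_def
proof (intro allI)
  fix c x
  have "(\<lambda>k. c *\<^sub>C (w k *\<^sub>R blinfun_apply (D k) x)) sums (c *\<^sub>C blinfun_apply (weighted w) x)"
    by (rule bounded_linear.sums[OF bounded_linear_scaleC weighted_sums])
  moreover have "c *\<^sub>C (w k *\<^sub>R blinfun_apply (D k) x) = w k *\<^sub>R blinfun_apply (D k) (c *\<^sub>C x)" for k
    by (simp add: projection_scaleC[OF projection_D]
        linear_simps(5)[OF bounded_linear_scaleC])
  ultimately show "blinfun_apply (weighted w) (c *\<^sub>C x) = c *\<^sub>C blinfun_apply (weighted w) x"
    using weighted_sums[of "c *\<^sub>C x"] sums_unique2 by auto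
qed

lemma weighted_eigenvector:
  assumes "blinfun_apply (D k) e = e"
  shows "blinfun_apply (weighted w) e = w k *\<^sub>R e"
proof -
  have "w j *\<^sub>R blinfun_apply (D j) e = (if j = k then w j *\<^sub>R e else 0)" for j
    using D_D[of j k e] assms by auto
  then have "(\<lambda>j. if j = k then w j *\<^sub>R e else 0) sums blinfun_apply (weighted w) e"
    using weighted_sums[of e] by simp
  then show ?thesis
    using sums_single by (rule sums_unique2)
qed

text \<open>The F n need not converge strongly to the identity; on the range of
  \<open>weighted w\<close> they do, because its vectors are sums of their D k components.\<close>

lemma F_weighted_tendsto:
  "(\<lambda>n. blinfun_apply (F n) (blinfun_apply (weighted w) x)) \<longlonglongrightarrow> blinfun_apply (weighted w) x"
  using weighted_sums[of x] unfolding sums_def D_weighted[symmetric] sum_D .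

text \<open>From index m on the components are w k D k x with w k at most w m. Pythagoras and Bessel
  bound every finite section uniformly, and the bound passes to the limit.\<close>

lemma norm_weighted_tail:
  "norm (blinfun_apply (weighted w) x - blinfun_apply (F m) (blinfun_apply (weighted w) x)) \<le> w m * norm x"
proof -
  let ?y = "blinfun_apply (weighted w) x"
  have "norm (blinfun_apply (F n) ?y - blinfun_apply (F m) ?y) \<le> w m * norm x" if "m \<le> n" for n
  proof -
    have "blinfun_apply (F n) ?y - blinfun_apply (F m) ?y = (\<Sum>k=m..<n. blinfun_apply (D k) ?y)"
      using sum_diff_nat_ivl[of 0 m n "\<lambda>k. blinfun_apply (D k) ?y"] that
      by (simp add: sum_D[symmetric] atLeast0LessThan)
    then have "(norm (blinfun_apply (F n) ?y - blinfun_apply (F m) ?y))\<^sup>2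
        = (\<Sum>k=m..<n. (norm (blinfun_apply (D k) ?y))\<^sup>2)"
      by (simp add: norm_sum_D projection_idem projection_D)
    also have "\<dots> = (\<Sum>k=m..<n. (w k)\<^sup>2 * (norm (blinfun_apply (D k) x))\<^sup>2)"
      by (simp add: D_weighted power_mult_distrib)
    also have "\<dots> \<le> (\<Sum>k=m..<n. (w m)\<^sup>2 * (norm (blinfun_apply (D k) x))\<^sup>2)"
      using weight_antimono weight_pos
      by (intro sum_mono mult_right_mono power_mono) (auto intro: less_imp_le)
    also have "\<dots> \<le> (\<Sum>k<n. (w m)\<^sup>2 * (norm (blinfun_apply (D k) x))\<^sup>2)"
      by (rule sum_mono2) auto
    also have "\<dots> \<le> (w m)\<^sup>2 * (norm x)\<^sup>2"
      unfolding sum_distrib_left[symmetric] by (intro mult_left_mono Bessel) simp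
    finally have "(norm (blinfun_apply (F n) ?y - blinfun_apply (F m) ?y))\<^sup>2 \<le> (w m * norm x)\<^sup>2"
      by (simp add: power_mult_distrib)
    then show ?thesis
      by (rule power2_le_imp_le) (simp add: less_imp_le[OF weight_pos])
  qed
  moreover have "(\<lambda>n. norm (blinfun_apply (F n) ?y - blinfun_apply (F m) ?y)) \<longlonglongrightarrow> norm (?y - blinfun_apply (F m) ?y)"
    by (intro tendsto_norm tendsto_diff F_weighted_tendsto tendsto_const)
  ultimately show ?thesis
    by (intro LIMSEQ_le_const2) auto
qed

text \<open>
  For \<open>y = weighted w x\<close> the component \<open>D k (T y)\<close> only sees \<open>D k y\<close> and the tail of \<open>y\<close> beyond
  \<open>F (Suc k)\<close>. After division by \<open>w k\<close> the first part is square summable by Bessel's inequality,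
  and the tail is because \<open>w (Suc k) / w k\<close> is.
\<close>

lemma weighted_range_invariant:
  assumes T: "T \<in> Alg L"
  shows "blinfun_apply T (blinfun_apply (weighted w) x) \<in> op_range (weighted w)"
proof -
  define y where "y = blinfun_apply (weighted w) x"
  define z where "z k = (1 / w k) *\<^sub>R blinfun_apply (D k) (blinfun_apply T y)" for k
  have TF: "blinfun_apply T (blinfun_apply (F n) v) = blinfun_apply (F n) (blinfun_apply T (blinfun_apply (F n) v))" for n v
  proof -
    have "T o\<^sub>L F n = F n o\<^sub>L T o\<^sub>L F n" using T F_in[of n] unfolding Alg_def by blast
    from arg_cong[OF this, of "\<lambda>X. blinfun_apply X v"] show ?thesis
      unfolding blinfun_apply_blinfun_compose .
  qed
  have Dz: "blinfun_apply (D k) (z k) = z k" for k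
    by (simp add: z_def blinfun.scaleR_right projection_idem projection_D)
  have bound: "norm (z k) \<le> norm T * (norm (blinfun_apply (D k) x) + (1/2) ^ k * norm x)" for k
  proof -
    let ?t = "y - blinfun_apply (F (Suc k)) y"
    have "y = blinfun_apply (F k) y + blinfun_apply (D k) y + ?t"
      by (simp add: D_def blinfun.diff_left)
    then have "blinfun_apply (D k) (blinfun_apply T y) = blinfun_apply (D k) (blinfun_apply T (blinfun_apply (F k) y))
        + blinfun_apply (D k) (blinfun_apply T (blinfun_apply (D k) y + ?t))"
      unfolding blinfun.add_right[symmetric] by (simp only: add.assoc)
    \<comment> \<open>T keeps the range of F k invariant, and D k vanishes on it: this is the upper
      triangular form of T.\<close>
    moreover have "blinfun_apply (D k) (blinfun_apply T (blinfun_apply (F k) y)) = 0"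
      by (subst TF, rule D_F) simp
    ultimately have "norm (blinfun_apply (D k) (blinfun_apply T y)) \<le> norm (blinfun_apply T (blinfun_apply (D k) y + ?t))"
      using norm_D_le by simp
    also have "\<dots> \<le> norm T * norm (blinfun_apply (D k) y + ?t)"
      by (rule norm_blinfun)
    also have "\<dots> \<le> norm T * (w k * norm (blinfun_apply (D k) x) + (1/2) ^ k * w k * norm x)"
    proof (rule mult_left_mono)
      have "norm ?t \<le> w (Suc k) * norm x"
        unfolding y_def by (rule norm_weighted_tail)
      also have "\<dots> \<le> (1/2) ^ k * w k * norm x"
        by (intro mult_right_mono weight_Suc) simp
      finally show "norm (blinfun_apply (D k) y + ?t) \<le> w k * norm (blinfun_apply (D k) x) + (1/2) ^ k * w k * norm x"
        using norm_triangle_ineq[of "blinfun_apply (D k) y" ?t] weight_pos[of k]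
        by (simp add: y_def D_weighted)
    qed simp
    also have "\<dots> = w k * (norm T * (norm (blinfun_apply (D k) x) + (1/2) ^ k * norm x))"
      by (simp add: algebra_simps)
    finally have "norm (blinfun_apply (D k) (blinfun_apply T y)) / w k
        \<le> norm T * (norm (blinfun_apply (D k) x) + (1/2) ^ k * norm x)"
      using weight_pos[of k] by (simp add: pos_divide_le_eq mult.commute)
    then show ?thesis
      using weight_pos[of k] by (simp add: z_def)
  qed
  have "summable (\<lambda>k. (norm (z k))\<^sup>2)"
  proof (rule summable_comparison_test'[of _ 0])
    \<comment> \<open>The factor 2 comes from (a + b)^2 \<le> 2 (a^2 + b^2), and 1/4 is the square
      of the ratio bound 1/2.\<close>
    show "summable (\<lambda>k. 2 * (norm T)\<^sup>2 * ((norm (blinfun_apply (D k) x))\<^sup>2 + (1/4) ^ k * (norm x)\<^sup>2))"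
      by (intro summable_mult summable_add summable_D summable_mult2 summable_geometric) simp
    show "norm ((norm (z k))\<^sup>2) \<le> 2 * (norm T)\<^sup>2 * ((norm (blinfun_apply (D k) x))\<^sup>2 + (1/4) ^ k * (norm x)\<^sup>2)" for k
    proof -
      define a b where "a = norm (blinfun_apply (D k) x)" and "b = (1/2) ^ k * norm x"
      have "(norm (z k))\<^sup>2 \<le> (norm T * (a + b))\<^sup>2"
        using bound[of k] unfolding a_def b_def by (intro power_mono) auto
      also have "\<dots> = (norm T)\<^sup>2 * (a + b)\<^sup>2"
        by (simp add: power_mult_distrib)
      also have "\<dots> \<le> (norm T)\<^sup>2 * (2 * (a\<^sup>2 + b\<^sup>2))"
        using sum_squares_bound[of a b] by (intro mult_left_mono) (auto simp: power2_sum)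
      also have "b\<^sup>2 = (1/4) ^ k * (norm x)\<^sup>2"
        by (simp add: b_def power_mult_distrib power2_eq_square flip: power_mult_distrib)
      finally show ?thesis by (simp add: a_def algebra_simps)
    qed
  qed
  then have "summable z" using Dz by (rule summable_orthogonal[rotated])
  then have zs: "z sums suminf z" by (rule summable_sums)
  \<comment> \<open>The k-th component of the sum of z is z k, and multiplying by w k restores D k
    (T y).\<close>
  have "(\<lambda>k. blinfun_apply (D k) (blinfun_apply T y)) sums blinfun_apply (weighted w) (suminf z)"
    using weighted_sums[of "suminf z"] weight_pos[THEN less_imp_neq]
    by (simp add: D_sums[OF Dz zs] z_def)
  then have "(\<lambda>n. blinfun_apply (F n) (blinfun_apply T y)) \<longlonglongrightarrow> blinfun_apply (weighted w) (suminf z)"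
    by (simp add: sums_def sum_D)
  \<comment> \<open>It remains to exclude a part of T y that no D k sees. Since T F n y tends to T y
    and is fixed by the contraction F n, F n (T y) has the same limit.\<close>
  moreover have "(\<lambda>n. blinfun_apply (F n) (blinfun_apply T y)) \<longlonglongrightarrow> blinfun_apply T y"
  proof -
    have TFy: "(\<lambda>n. blinfun_apply T (blinfun_apply (F n) y)) \<longlonglongrightarrow> blinfun_apply T y"
      unfolding y_def by (intro blinfun.tendsto tendsto_const F_weighted_tendsto)
    then have "(\<lambda>n. blinfun_apply T y - blinfun_apply T (blinfun_apply (F n) y)) \<longlonglongrightarrow> 0"
      using tendsto_diff[OF tendsto_const TFy, of "blinfun_apply T y"] by simp
    then have "(\<lambda>n. blinfun_apply (F n) (blinfun_apply T y - blinfun_apply T (blinfun_apply (F n) y))) \<longlonglongrightarrow> 0"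
      by (rule Lim_null_comparison[rotated, OF tendsto_norm_zero])
        (simp add: norm_projection_le proj F_in)
    then have "(\<lambda>n. blinfun_apply (F n) (blinfun_apply T y) - blinfun_apply T (blinfun_apply (F n) y)) \<longlonglongrightarrow> 0"
      by (simp add: blinfun.diff_right TF[symmetric])
    from tendsto_add[OF this TFy] show ?thesis by simp
  qed
  ultimately have "blinfun_apply T y = blinfun_apply (weighted w) (suminf z)"
    by (rule LIMSEQ_unique[rotated])
  then show ?thesis unfolding y_def op_range_def by simp
qed

lemma invariant_operator_range_weighted: "invariant_operator_range L (op_range (weighted w))"
proof -
  have "csubspace (op_range (weighted w))"
    unfolding complex_vector.subspace_def op_range_def
  proof (intro conjI ballI allI)
    show "0 \<in> range (blinfun_apply (weighted w))"
      by (rule range_eqI[of _ _ 0]) (simp add: blinfun.zero_right)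
    show "u + v \<in> range (blinfun_apply (weighted w))"
      if "u \<in> range (blinfun_apply (weighted w))" "v \<in> range (blinfun_apply (weighted w))" for u v
      using that by (auto simp flip: blinfun.add_right)
    show "c *\<^sub>C u \<in> range (blinfun_apply (weighted w))"
      if "u \<in> range (blinfun_apply (weighted w))" for c u
      using that by (auto simp: bounded_op_weighted[unfolded bounded_op_def, rule_format, symmetric])
  qed
  then show ?thesis
    using bounded_op_weighted weighted_range_invariant
    unfolding invariant_operator_range_def operator_range_def invariant_manifold_def
    by (auto simp: op_range_def)
qed

text \<open>If s = \<open>weighted w\<close> x, comparing k-th components gives a k e k = w k D k x,
  so norm x serves as C.\<close>

lemma weighted_coefficient_bound:
  assumes e: "\<And>k. blinfun_apply (D k) (e k) = e k" "\<And>k. norm (e k) = 1"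
    and s: "(\<lambda>k. a k *\<^sub>R e k) sums s" "s \<in> op_range (weighted w)"
  obtains C where "\<And>k. a k \<le> w k * C"
proof -
  obtain x where x: "s = blinfun_apply (weighted w) x" using s(2) by (auto simp: op_range_def)
  have "a k \<le> w k * norm x" for k
  proof -
    have "a k *\<^sub>R e k = blinfun_apply (D k) s"
      by (rule D_sums[OF _ s(1), symmetric]) (simp add: blinfun.scaleR_right e)
    also have "\<dots> = w k *\<^sub>R blinfun_apply (D k) x"
      unfolding x by (rule D_weighted)
    finally have "norm (a k *\<^sub>R e k) = norm (w k *\<^sub>R blinfun_apply (D k) x)" by simp
    then have "\<bar>a k\<bar> = w k * norm (blinfun_apply (D k) x)"
      using weight_pos[of k] by (simp add: e(2))
    also have "\<dots> \<le> w k * norm x"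
      using weight_pos[of k] by (intro mult_left_mono norm_D_le) simp
    finally show ?thesis by simp
  qed
  then show ?thesis by (rule that)
qed

end

section \<open>Weight inequalities forced by closedness and containment\<close>

lemma obtain_unit_vectors:
  obtains e where "\<And>k. blinfun_apply (D k) (e k) = e k" "\<And>k. norm (e k) = 1"
proof -
  have "\<exists>v. blinfun_apply (D k) v = v \<and> norm v = 1" for k
  proof -
    have "D k \<noteq> 0" using F_less[of k] by (auto simp: D_def proj_less_def)
    then obtain u where u: "blinfun_apply (D k) u \<noteq> 0" by (metis blinfun_eqI zero_blinfun.rep_eq)
    show ?thesis
      using u by (intro exI[of _ "(1 / norm (blinfun_apply (D k) u)) *\<^sub>R blinfun_apply (D k) u"])
        (simp add: blinfun.scaleR_right projection_idem projection_D)
  qed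
  then have "\<forall>k. \<exists>v. blinfun_apply (D k) v = v \<and> norm v = 1" ..
  then show ?thesis using that by (auto dest!: choice)
qed

lemma summable_unit_vectors:
  fixes e :: "nat \<Rightarrow> 'a"
  assumes "\<And>k. norm (e k) = 1"
  shows "summable (\<lambda>k. (1/2) ^ k *\<^sub>R e k)"
  by (rule summable_norm_cancel) (simp add: assms summable_geometric)

text \<open>The e k are eigenvectors with nonzero eigenvalues, so the range contains all their
  finite combinations. Closedness would add the sum of a geometric series, which rapidly decreasing
  weights cannot reach.\<close>

lemma closed_weighted_range_bound:
  assumes w: "weight w" and closed: "closed (op_range (weighted w))"
  obtains C where "\<And>k. (1/2) ^ k \<le> w k * C"
proof -
  obtain e where e: "\<And>k. blinfun_apply (D k) (e k) = e k" "\<And>k. norm (e k) = 1"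
    using obtain_unit_vectors by blast
  define s where "s = (\<Sum>k. (1/2) ^ k *\<^sub>R e k)"
  have s: "(\<lambda>k. (1/2) ^ k *\<^sub>R e k) sums s"
    unfolding s_def using summable_unit_vectors[OF e(2)] by (rule summable_sums)
  have "(\<Sum>k<n. (1/2) ^ k *\<^sub>R e k) = blinfun_apply (weighted w) (\<Sum>k<n. ((1/2) ^ k / w k) *\<^sub>R e k)" for n
    using weight_pos[OF w, THEN less_imp_neq]
    by (simp add: blinfun.sum_right blinfun.scaleR_right weighted_eigenvector[OF w e(1)])
  then have "(\<Sum>k<n. (1/2) ^ k *\<^sub>R e k) \<in> op_range (weighted w)" for n
    by (simp add: op_range_def)
  then have "s \<in> op_range (weighted w)"
    by (rule closed_sequentially[OF closed]) (use s in \<open>simp add: sums_def\<close>)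
  then show ?thesis by (rule weighted_coefficient_bound[OF w e s]) (rule that)
qed

text \<open>The test vector is the image under \<open>weighted w\<close> of a geometric series in
  the e k; its coefficients cause the loss of (1/2)^k on the left.\<close>

lemma weighted_range_subset_bound:
  assumes w: "weight w" and v: "weight v" and sub: "op_range (weighted w) \<subseteq> op_range (weighted v)"
  obtains C where "\<And>k. (1/2) ^ k * w k \<le> v k * C"
proof -
  obtain e where e: "\<And>k. blinfun_apply (D k) (e k) = e k" "\<And>k. norm (e k) = 1"
    using obtain_unit_vectors by blast
  let ?x = "\<Sum>k. (1/2) ^ k *\<^sub>R e k"
  have "(\<lambda>k. blinfun_apply (weighted w) ((1/2) ^ k *\<^sub>R e k)) sums blinfun_apply (weighted w) ?x"
    using summable_unit_vectors[OF e(2)]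
    by (intro bounded_linear.sums[OF blinfun.bounded_linear_right] summable_sums)
  then have "(\<lambda>k. ((1/2) ^ k * w k) *\<^sub>R e k) sums blinfun_apply (weighted w) ?x"
    by (simp add: blinfun.scaleR_right weighted_eigenvector[OF w e(1)])
  moreover have "blinfun_apply (weighted w) ?x \<in> op_range (weighted v)"
    using sub by (auto simp: op_range_def)
  ultimately show ?thesis by (rule weighted_coefficient_bound[OF v e]) (rule that)
qed

end

lemma half_power_small:
  obtains N where "\<And>k. k \<ge> N \<Longrightarrow> (1/2) ^ k * C < (1::real)"
proof -
  have "(\<lambda>k. (1/2) ^ k * C) \<longlonglongrightarrow> 0 * C"
    by (intro tendsto_mult LIMSEQ_power_zero tendsto_const) simp
  then have "\<forall>\<^sub>F k in sequentially. (1/2) ^ k * C < 1"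
    by (intro order_tendstoD) auto
  then show ?thesis using that unfolding eventually_sequentially by blast
qed

text \<open>Positivity of the left side forces C > 0, after which (1/2)^p cancels. With a large gap
  k the conclusion contradicts \<open>half_power_small\<close>.\<close>

lemma half_power_gap:
  assumes "(1/2) ^ p \<le> (1/2) ^ q * (C::real)" "p + k \<le> q"
  shows "1 \<le> (1/2) ^ k * C"
proof -
  have "0 < (1/2) ^ q * C"
    using assms(1) by (rule less_le_trans[rotated]) simp
  then have "0 < C" by (simp add: zero_less_mult_iff)
  then have "(1/2) ^ q * C \<le> (1/2) ^ (p + k) * C"
    using power_decreasing[OF assms(2), of "1/2 :: real"] by (intro mult_right_mono) auto
  with assms(1) have "(1/2) ^ p \<le> (1/2) ^ (p + k) * C"
    by (rule order_trans)
  then show ?thesis by (simp add: power_add mult.assoc)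
qed

text \<open>
  The exponents \<open>p\<close> and \<open>q\<close> cross infinitely often, with gaps \<open>2 * k\<close> in both directions, so
  neither weighted range contains the other.
\<close>

lemma (in csl_chain) nonclosed_incomparable_operator_ranges:
  obtains M N where "invariant_operator_range L M" "invariant_operator_range L N"
    "\<not> closed M" "\<not> M \<subseteq> N" "\<not> N \<subseteq> M"
proof -
  \<comment> \<open>The term 6 k^2 rises by 12 k + 6 per step, enough to absorb the drop of 4 k in q
    after an even index and still give the growth that \<open>weight\<close> asks for. At even k, q
    exceeds p by 2 k, at odd k it falls short by 2 k: one k pays for the test factor (1/2)^k, the
    other is the remaining gap.\<close>
  define p q :: "nat \<Rightarrow> nat" where "p k = 6 * k * k + 2 * k"
    and "q k = 6 * k * k + (if even k then 4 * k else 0)" for k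
  define w v :: "nat \<Rightarrow> real" where "w k = (1/2) ^ p k" and "v k = (1/2) ^ q k" for k
  have step: "weight (\<lambda>k. (1/2) ^ r k)" if "\<And>k. k + r k \<le> r (Suc k)" for r :: "nat \<Rightarrow> nat"
    unfolding weight_def power_add[symmetric] using that by (auto intro!: power_decreasing)
  have w: "weight w" unfolding w_def p_def by (rule step) (simp add: algebra_simps)
  have v: "weight v" unfolding v_def q_def by (rule step) (simp add: algebra_simps)
  have "\<not> closed (op_range (weighted w))"
  proof
    assume "closed (op_range (weighted w))"
    then obtain C where C: "\<And>k. (1/2) ^ k \<le> w k * C"
      using closed_weighted_range_bound[OF w] by blast
    obtain N where N: "\<And>k. k \<ge> N \<Longrightarrow> (1/2) ^ k * C < 1" using half_power_small by blast
    have "1 \<le> (1/2) ^ N * C"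
      using half_power_gap[of N "p N" C N] C[of N] by (simp add: w_def p_def)
    then show False using N[of N] by simp
  qed
  moreover have "\<not> op_range (weighted w) \<subseteq> op_range (weighted v)"
  proof
    assume "op_range (weighted w) \<subseteq> op_range (weighted v)"
    then obtain C where C: "\<And>k. (1/2) ^ k * w k \<le> v k * C"
      using weighted_range_subset_bound[OF w v] by blast
    obtain N where N: "\<And>k. k \<ge> N \<Longrightarrow> (1/2) ^ k * C < 1" using half_power_small by blast
    \<comment> \<open>The index 2 N is even and at least N, so here q is the larger
      exponent.\<close>
    have "1 \<le> (1/2) ^ (2 * N) * C"
      using C[of "2 * N"] unfolding w_def v_def power_add[symmetric]
      by (rule half_power_gap) (simp add: p_def q_def)
    then show False using N[of "2 * N"] by simp
  qed
  moreover have "\<not> op_range (weighted v) \<subseteq> op_range (weighted w)"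
  proof
    assume "op_range (weighted v) \<subseteq> op_range (weighted w)"
    then obtain C where C: "\<And>k. (1/2) ^ k * v k \<le> w k * C"
      using weighted_range_subset_bound[OF v w] by blast
    obtain N where N: "\<And>k. k \<ge> N \<Longrightarrow> (1/2) ^ k * C < 1" using half_power_small by blast
    \<comment> \<open>At an odd index the roles of p and q are exchanged.\<close>
    have "1 \<le> (1/2) ^ (2 * N + 1) * C"
      using C[of "2 * N + 1"] unfolding w_def v_def power_add[symmetric]
      by (rule half_power_gap) (simp add: p_def q_def)
    then show False using N[of "2 * N + 1"] by simp
  qed
  ultimately show ?thesis
    using that invariant_operator_range_weighted w v by blast
qed

lemma not_wf_imp_nonclosed_incomparable_operator_ranges:
  fixes L :: "('a::chilbert_space \<Rightarrow>\<^sub>L 'a) set"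
  assumes "csl L" "\<not> wf (csl.above L)"
  obtains M N where "invariant_operator_range L M" "invariant_operator_range L N"
    "\<not> closed M" "\<not> M \<subseteq> N" "\<not> N \<subseteq> M"
proof -
  interpret csl L by fact
  obtain F where "\<And>i. (F (Suc i), F i) \<in> above"
    using assms(2) unfolding wf_iff_no_infinite_down_chain by blast
  then have F: "F i \<in> L" "F i \<prec> F (Suc i)" for i by (auto simp: above_def)
  \<comment> \<open>Only the first term is replaced by 0; the chain stays strict because F 0 is
    strictly below F 1.\<close>
  define G where "G n = (case n of 0 \<Rightarrow> 0 | Suc m \<Rightarrow> F (Suc m))" for n
  have "0 \<prec> F (Suc 0)"
    using le_less_trans[OF zero_in F(1) F(1) zero_le[OF F(1)] F(2)] by blast
  then interpret csl_chain L G
    by unfold_locales (auto simp: G_def F zero_in split: nat.split)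
  show ?thesis using nonclosed_incomparable_operator_ranges that by blast
qed

theorem mainTheorem1:
  fixes L :: "('a::chilbert_space \<Rightarrow>\<^sub>L 'a) set"
  assumes separable: "separable_space (euclidean :: 'a topology)"
    and csl: "commutative_subspace_lattice L"
  shows "(hyperatomic L \<longleftrightarrow> ascending_stabilizes L)
    \<and> (hyperatomic L \<longleftrightarrow> (\<forall>M. invariant_operator_range L M \<longrightarrow> closed M))
    \<and> (hyperatomic L \<longleftrightarrow> (\<forall>M. invariant_manifold L M \<longrightarrow> closed M))
    \<and> ((\<forall>M. invariant_operator_range L M \<longrightarrow> closed M) \<longrightarrow>
         (\<forall>M. invariant_operator_range L M \<longrightarrow> (\<exists>P\<in>L. op_range P = M)))
    \<and> ((\<forall>M. invariant_manifold L M \<longrightarrow> closed M) \<longrightarrow>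
         (\<forall>M. invariant_manifold L M \<longrightarrow> (\<exists>P\<in>L. op_range P = M)))
    \<and> (nest L \<longrightarrow>
         (hyperatomic L \<longleftrightarrow> (\<forall>P\<in>L. P \<noteq> 0 \<longrightarrow> has_immediate_predecessor L P))
       \<and> (hyperatomic L \<longleftrightarrow> totally_ordered {M. invariant_operator_range L M})
       \<and> (hyperatomic L \<longleftrightarrow> totally_ordered {M. invariant_manifold L M}))"
proof -
  interpret csl L by unfold_locales (rule csl)
  have hyp: "hyperatomic L \<longleftrightarrow> wf above"
    using ascending_stabilizes_iff_wf hyperatomic_imp_ascending_stabilizes wf_imp_hyperatomic by blast
  have good: "\<exists>P\<in>L. op_range P = M" if "wf above" "invariant_manifold L M" for M
    using wf_imp_invariant_manifold_in that by blast
  have good': "closed M" if "wf above" "invariant_manifold L M" for M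
    using good[OF that] closed_range_projection proj by blast
  \<comment> \<open>Operator ranges are special invariant manifolds. The positive result, proved for
    manifolds, and the counterexamples, which are operator ranges, therefore each settle both kinds
    of condition.\<close>
  have op: "invariant_manifold L M" if "invariant_operator_range L M" for M
    using that by (simp add: invariant_operator_range_def)
  have c3: "wf above \<longleftrightarrow> (\<forall>M. invariant_operator_range L M \<longrightarrow> closed M)"
    using good' op not_wf_imp_nonclosed_incomparable_operator_ranges[OF csl_axioms] by metis
  have c4: "wf above \<longleftrightarrow> (\<forall>M. invariant_manifold L M \<longrightarrow> closed M)"
    using good' op c3 by blast
  have c67: "(wf above \<longleftrightarrow> totally_ordered {M. invariant_operator_range L M})
      \<and> (wf above \<longleftrightarrow> totally_ordered {M. invariant_manifold L M})" if nest: "nest L"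
  proof -
    have "totally_ordered {M. invariant_manifold L M}" if wf: "wf above"
      unfolding totally_ordered_def
    proof (intro ballI)
      fix M N assume "M \<in> {M. invariant_manifold L M}" "N \<in> {M. invariant_manifold L M}"
      then obtain P Q where "P \<in> L" "op_range P = M" "Q \<in> L" "op_range Q = N"
        using good[OF wf] by (metis mem_Collect_eq)
      then show "M \<subseteq> N \<or> N \<subseteq> M"
        using nest unfolding nest_def proj_le_def by blast
    qed
    moreover have "totally_ordered {M. invariant_operator_range L M}"
      if "totally_ordered {M. invariant_manifold L M}"
      using that op unfolding totally_ordered_def by blast
    moreover have "wf above" if "totally_ordered {M. invariant_operator_range L M}"
      using that not_wf_imp_nonclosed_incomparable_operator_ranges[OF csl_axioms] unfolding totally_ordered_def
      by (metis mem_Collect_eq)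
    ultimately show ?thesis by blast
  qed
  have c567: "nest L \<longrightarrow>
      (wf above \<longleftrightarrow> (\<forall>P\<in>L. P \<noteq> 0 \<longrightarrow> has_immediate_predecessor L P))
      \<and> (wf above \<longleftrightarrow> totally_ordered {M. invariant_operator_range L M})
      \<and> (wf above \<longleftrightarrow> totally_ordered {M. invariant_manifold L M})"
    by (intro impI conjI nest_predecessor_iff c67[THEN conjunct1] c67[THEN conjunct2])
  have in3: "(\<forall>M. invariant_operator_range L M \<longrightarrow> closed M) \<longrightarrow>
      (\<forall>M. invariant_operator_range L M \<longrightarrow> (\<exists>P\<in>L. op_range P = M))"
    unfolding c3[symmetric] using good op by simp
  have in4: "(\<forall>M. invariant_manifold L M \<longrightarrow> closed M) \<longrightarrow>
      (\<forall>M. invariant_manifold L M \<longrightarrow> (\<exists>P\<in>L. op_range P = M))"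
    unfolding c4[symmetric] using good by simp
  show ?thesis
    unfolding hyp ascending_stabilizes_iff_wf
    by (rule conjI[OF refl conjI[OF c3 conjI[OF c4 conjI[OF in3 conjI[OF in4 c567]]]]])
qed

end
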